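(* Let $\mathcal{H}$ be a complex Hilbert space and let $\mathbf{T}:\mathcal{D}_{\mathbf{T}}\subseteq\mathcal{H}\to\mathcal{H}$ be a closed linear (possibly unbounded) operator. Then $$\mathrm{cl}\,\mathrm{SRG}(\mathbf{T})=\bigcap_{\alpha\in\mathbb{R}}\mathrm{Ann}(\mathbf{T},\alpha),$$ where $\mathrm{cl}$ denotes closure in the extended complex plane.
   Context: Let $\hat{\mathbb{C}}=\mathbb{C}\cup\{\infty\}$ be the extended complex plane with the chordal metric. A linear (possibly unbounded) operator $\mathbf{T}:\mathcal{D}_{\mathbf{T}}\subseteq\mathcal{H}\to\mathcal{H}$ is a linear map whose domain $\mathcal{D}_{\mathbf{T}}$ is a linear subspace of $\mathcal{H}$ (not necessarily dense or closed). It is closed if its graph $\mathcal{G}_{\mathbf{T}}=\{(u,\mathbf{T}u):u\in\mathcal{D}_{\mathbf{T}}\}$ is closed in $\mathcal{H}\times\mathcal{H}$. $\mathbf{I}$ is the identity operator. The Scaled Relative Graph of $\mathbf{T}$ is $$\mathrm{SRG}(\mathbf{T})=\left\{\frac{\|y\|}{\|u\|}\exp(\pm i\angle(u,y)):u\in\mathcal{D}_{\mathbf{T}}\setminus\{0\},\ y=\mathbf{T}u\right\}\subseteq\hat{\mathbb{C}},$$ where $\angle(u,y)\in[0,\pi]$ is defined by $\cos\angle(u,y)=\frac{\mathrm{Re}\langle y,u\rangle}{\|y\|\|u\|}$ if $y\neq0$, and $\angle(u,y)=0$ if $y=0$. The maximum and minimum gains are $$\bar\sigma(\mathbf{T})=\sup_{u\in\mathcal{D}_{\mathbf{T}},\,u\ne0}\frac{\|\mathbf{T}u\|}{\|u\|},\qquad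 \underline{\sigma}(\mathbf{T})=\inf_{u\in\mathcal{D}_{\mathbf{T}},\,u\ne0}\frac{\|\mathbf{T}u\|}{\|u\|},$$ and for $\alpha\in\mathbb{R}$ the annulus of $\mathbf{T}$ is $$\mathrm{Ann}(\mathbf{T},\alpha)=\{\alpha+z:\underline{\sigma}(\mathbf{T}-\alpha\mathbf{I})\le|z|\le\bar\sigma(\mathbf{T}-\alpha\mathbf{I})\}\subseteq\hat{\mathbb{C}},$$ where $\mathbf{T}-\alpha\mathbf{I}$ has domain $\mathcal{D}_{\mathbf{T}}$. By convention $\infty\in\mathrm{Ann}(\mathbf{T},\alpha)$ if $\bar\sigma(\mathbf{T}-\alpha\mathbf{I})=\infty$, and $\mathrm{Ann}(\mathbf{T},\alpha)=\{\infty\}$ if both gains are $\infty$. *)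

theory Defs
  imports "HOL-Analysis.Analysis"
begin

section \<open>The extended complex plane with the chordal metric\<close>

datatype ecomplex = Fin complex | Infty

fun chordal :: "ecomplex \<Rightarrow> ecomplex \<Rightarrow> real" where
  "chordal (Fin z) (Fin w) =
     2 * cmod (z - w) / (sqrt (1 + (cmod z)\<^sup>2) * sqrt (1 + (cmod w)\<^sup>2))"
| "chordal (Fin z) Infty = 2 / sqrt (1 + (cmod z)\<^sup>2)"
| "chordal Infty (Fin w) = 2 / sqrt (1 + (cmod w)\<^sup>2)"
| "chordal Infty Infty = 0"

text \<open>The inverse stereographic projection onto the unit sphere sends \<^term>\<open>z\<close> to
  \<^term>\<open>(0, 1) + 2 *\<^sub>R (z /\<^sub>R (1 + (cmod z)\<^sup>2), - 1 / (1 + (cmod z)\<^sup>2))\<close> and infinity to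
  \<^term>\<open>(0, 1)\<close>; \<open>stereo\<close> is the bracketed part, reflected in the second
  coordinate.\<close>

fun stereo :: "ecomplex \<Rightarrow> complex \<times> real" where
  "stereo (Fin z) = (z /\<^sub>R (1 + (cmod z)\<^sup>2), 1 / (1 + (cmod z)\<^sup>2))"
| "stereo Infty = (0, 0)"

lemma stereo_inner_self:
  "stereo (Fin z) \<bullet> stereo (Fin z) = 1 / (1 + (cmod z)\<^sup>2)"
proof -
  define a where "a = 1 + (cmod z)\<^sup>2"
  have "a > 0" by (simp add: a_def add_pos_nonneg)
  moreover have "z \<bullet> z = a - 1" by (simp add: a_def power2_norm_eq_inner)
  ultimately show ?thesis by (simp add: a_def [symmetric] field_simps)
qed

lemma chordal_stereo: "chordal p q = 2 * dist (stereo p) (stereo q)"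
proof -
  have fin: "norm (stereo (Fin z)) = 1 / sqrt (1 + (cmod z)\<^sup>2)" for z
    by (simp only: norm_eq_sqrt_inner stereo_inner_self real_sqrt_divide real_sqrt_one)
  show ?thesis
  proof (cases p; cases q)
    fix z w assume [simp]: "p = Fin z" "q = Fin w"
    define a b where "a = 1 + (cmod z)\<^sup>2" and "b = 1 + (cmod w)\<^sup>2"
    have ab: "a > 0" "b > 0" by (simp_all add: a_def b_def add_pos_nonneg)
    have "(dist (stereo p) (stereo q))\<^sup>2
        = stereo p \<bullet> stereo p + stereo q \<bullet> stereo q - 2 * (stereo p \<bullet> stereo q)"
      by (simp only: dist_norm power2_norm_eq_inner inner_diff_left inner_diff_right)
         (simp add: inner_commute del: stereo.simps)
    also have "\<dots> = 1 / a + 1 / b - 2 * ((z \<bullet> w + 1) / (a * b))"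
    proof -
      have "stereo p \<bullet> stereo q = (z \<bullet> w + 1) / (a * b)"
        using ab by (simp add: a_def [symmetric] b_def [symmetric] field_simps)
      then show ?thesis by (simp only: \<open>p = _\<close> \<open>q = _\<close> stereo_inner_self a_def b_def)
    qed
    also have "\<dots> = (a + b - 2 * (z \<bullet> w) - 2) / (a * b)"
      using ab by (simp add: field_simps)
    also have "a + b - 2 * (z \<bullet> w) - 2 = (cmod (z - w))\<^sup>2"
      by (simp add: a_def b_def power2_norm_eq_inner inner_diff_left inner_diff_right inner_commute)
    finally have "dist (stereo p) (stereo q) = sqrt ((cmod (z - w))\<^sup>2 / (a * b))"
      by (metis real_sqrt_abs abs_of_nonneg zero_le_dist)
    then show ?thesis
      by (simp add: real_sqrt_divide real_sqrt_mult a_def b_def del: stereo.simps)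
  next
    fix z assume "p = Fin z" "q = Infty"
    then show ?thesis using fin [of z] by (simp add: dist_norm zero_prod_def [symmetric] del: stereo.simps(1))
  next
    fix w assume "p = Infty" "q = Fin w"
    then show ?thesis using fin [of w]
      by (simp add: dist_norm norm_minus_commute zero_prod_def [symmetric] del: stereo.simps(1))
  qed simp
qed

lemma stereo_inject: "stereo p = stereo q \<longleftrightarrow> p = q"
proof
  have ne: "1 + (cmod z)\<^sup>2 \<noteq> 0" for z by (smt (verit) zero_le_power2)
  assume "stereo p = stereo q"
  then show "p = q" by (cases p; cases q) (auto simp: ne)
qed simp

instantiation ecomplex :: metric_space
begin

definition dist_ecomplex :: "ecomplex \<Rightarrow> ecomplex \<Rightarrow> real" where
  "dist_ecomplex = chordal"

definition uniformity_ecomplex :: "(ecomplex \<times> ecomplex) filter" where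
  "uniformity_ecomplex = (INF e\<in>{0<..}. principal {(x, y). dist x y < e})"

definition open_ecomplex :: "ecomplex set \<Rightarrow> bool" where
  "open_ecomplex U \<longleftrightarrow> (\<forall>x\<in>U. eventually (\<lambda>(x', y). x' = x \<longrightarrow> y \<in> U) uniformity)"

instance
proof
  fix p q r :: ecomplex
  show "dist p q = 0 \<longleftrightarrow> p = q"
    by (simp add: dist_ecomplex_def chordal_stereo stereo_inject)
  show "dist p q \<le> dist p r + dist q r"
    using dist_triangle2 [of "stereo p" "stereo q" "stereo r"]
    by (simp add: dist_ecomplex_def chordal_stereo)
qed (rule uniformity_ecomplex_def open_ecomplex_def)+

end


section \<open>Complex Hilbert spaces\<close>

class complex_inner = real_normed_vector +
  fixes scaleC :: "complex \<Rightarrow> 'a \<Rightarrow> 'a" (infixr \<open>*\<^sub>C\<close> 75)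
    and cinner :: "'a \<Rightarrow> 'a \<Rightarrow> complex"
  assumes scaleC_add_right: "c *\<^sub>C (x + y) = c *\<^sub>C x + c *\<^sub>C y"
    and scaleC_add_left: "(c + d) *\<^sub>C x = c *\<^sub>C x + d *\<^sub>C x"
    and scaleC_scaleC: "c *\<^sub>C (d *\<^sub>C x) = (c * d) *\<^sub>C x"
    and scaleC_one: "1 *\<^sub>C x = x"
    and scaleR_scaleC: "r *\<^sub>R x = complex_of_real r *\<^sub>C x"
    and cinner_commute: "cinner x y = cnj (cinner y x)"
    and cinner_add_left: "cinner (x + y) z = cinner x z + cinner y z"
    and cinner_scaleC_left: "cinner (c *\<^sub>C x) y = c * cinner x y"
    and cinner_ge_zero: "0 \<le> Re (cinner x x)"
    and cinner_eq_zero_iff: "cinner x x = 0 \<longleftrightarrow> x = 0"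
    and norm_eq_sqrt_cinner: "norm x = sqrt (Re (cinner x x))"

class chilbert_space = complex_inner + complete_space

interpretation complex_vector: vector_space "scaleC :: complex \<Rightarrow> 'a \<Rightarrow> 'a::complex_inner"
  by unfold_locales (rule scaleC_add_right scaleC_add_left scaleC_scaleC scaleC_one)+

instantiation complex :: chilbert_space
begin

definition scaleC_complex :: "complex \<Rightarrow> complex \<Rightarrow> complex" where
  "scaleC_complex c x = c * x"

definition cinner_complex :: "complex \<Rightarrow> complex \<Rightarrow> complex" where
  "cinner_complex x y = x * cnj y"

instance
  by standard
    (auto simp: scaleC_complex_def cinner_complex_def algebra_simps scaleR_conv_of_real
      cmod_def power2_eq_square)

end


section \<open>Linear operators, their gains and annuli, and the scaled relative graph\<close>

text \<open>An operator is a pair of a domain \<^term>\<open>D\<close> and a total function \<^term>\<open>T\<close> whose values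
  outside \<^term>\<open>D\<close> are irrelevant.\<close>

definition linear_operator :: "'h::complex_inner set \<Rightarrow> ('h \<Rightarrow> 'h) \<Rightarrow> bool" where
  "linear_operator D T \<longleftrightarrow>
     complex_vector.subspace D \<and>
     (\<forall>x\<in>D. \<forall>y\<in>D. T (x + y) = T x + T y) \<and>
     (\<forall>c. \<forall>x\<in>D. T (c *\<^sub>C x) = c *\<^sub>C T x)"

definition operator_graph :: "'h set \<Rightarrow> ('h \<Rightarrow> 'h) \<Rightarrow> ('h \<times> 'h) set" where
  "operator_graph D T = {(u, T u) | u. u \<in> D}"

definition closed_operator :: "'h::complex_inner set \<Rightarrow> ('h \<Rightarrow> 'h) \<Rightarrow> bool" where
  "closed_operator D T \<longleftrightarrow> linear_operator D T \<and> closed (operator_graph D T)"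

definition angle :: "'h::complex_inner \<Rightarrow> 'h \<Rightarrow> real" where
  "angle u y = (if y = 0 then 0 else arccos (Re (cinner y u) / (norm y * norm u)))"

definition SRG :: "'h::complex_inner set \<Rightarrow> ('h \<Rightarrow> 'h) \<Rightarrow> ecomplex set" where
  "SRG D T =
     {Fin (complex_of_real (norm (T u) / norm u) *
           exp (complex_of_real s * \<i> * complex_of_real (angle u (T u)))) | u s.
        u \<in> D - {0} \<and> s \<in> {1, - 1}}"

definition max_gain :: "'h::complex_inner set \<Rightarrow> ('h \<Rightarrow> 'h) \<Rightarrow> ennreal" where
  "max_gain D T = (SUP u\<in>D - {0}. ennreal (norm (T u) / norm u))"

definition min_gain :: "'h::complex_inner set \<Rightarrow> ('h \<Rightarrow> 'h) \<Rightarrow> ennreal" where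
  "min_gain D T = (INF u\<in>D - {0}. ennreal (norm (T u) / norm u))"

text \<open>If both gains are infinite, no finite point satisfies the inequalities and the annulus
  is \<^term>\<open>{Infty}\<close>. On the domain \<^term>\<open>{0}\<close> the maximum gain is 0 and the minimum gain is
  infinite, so the annulus is empty, like the scaled relative graph.\<close>

definition Ann :: "'h::complex_inner set \<Rightarrow> ('h \<Rightarrow> 'h) \<Rightarrow> real \<Rightarrow> ecomplex set" where
  "Ann D T \<alpha> =
     (let S = (\<lambda>u. T u - \<alpha> *\<^sub>R u) in
       {Fin (complex_of_real \<alpha> + z) | z.
          min_gain D S \<le> ennreal (cmod z) \<and> ennreal (cmod z) \<le> max_gain D S} \<union>
       {p. p = Infty \<and> max_gain D S = \<infinity>})"

end

theory Submission
  imports Defs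
begin

text \<open>A unit vector \<open>u\<close> with \<open>x = Re \<langle>Tu, u\<rangle>\<close> and \<open>r = \<parallel>Tu\<parallel>\<^sup>2\<close> contributes the points \<open>z\<close> with
  \<open>Re z = x\<close> and \<open>\<bar>z\<bar>\<^sup>2 = r\<close>. By the Toeplitz--Hausdorff argument the set \<open>W\<close> of all pairs
  \<open>(x, r)\<close> is convex. Since \<open>\<parallel>Tu - \<alpha>u\<parallel>\<^sup>2 = r - 2\<alpha>x + \<alpha>\<^sup>2\<close>, the annuli impose exactly the
  conditions that non-vertical supporting lines impose on \<open>closure W\<close>; vertical
  lines add nothing, because \<open>r \<ge> 0\<close> on \<open>W\<close> allows one to tilt them.\<close>

section \<open>The real inner product of a complex inner product space\<close>

lemma cinner_add_right: "cinner x (y + z) = cinner x y + cinner (x::'a::complex_inner) z"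
  by (metis cinner_add_left cinner_commute complex_cnj_add)

lemma cinner_scaleC_right: "cinner x (c *\<^sub>C y) = cnj c * cinner (x::'a::complex_inner) y"
  by (metis cinner_scaleC_left cinner_commute complex_cnj_mult)

lemma Re_cinner_commute: "Re (cinner x y) = Re (cinner y (x::'a::complex_inner))"
  by (metis cinner_commute complex_cnj(1) complex.sel(1) complex.exhaust_sel)

lemma power2_norm_eq_cinner: "(norm (x::'a::complex_inner))\<^sup>2 = Re (cinner x x)"
  by (simp add: norm_eq_sqrt_cinner cinner_ge_zero)

lemma Re_cinner_scaleR_left: "Re (cinner (r *\<^sub>R x) y) = r * Re (cinner x (y::'a::complex_inner))"
  by (simp add: scaleR_scaleC cinner_scaleC_left)

lemma Re_cinner_scaleR_right: "Re (cinner x (r *\<^sub>R y)) = r * Re (cinner x (y::'a::complex_inner))"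
  by (simp add: scaleR_scaleC cinner_scaleC_right)

lemmas Re_cinner_simps =
  cinner_add_left cinner_add_right plus_complex.sel(1) Re_cinner_scaleR_left Re_cinner_scaleR_right

lemma power2_norm_add_scaleR:
  fixes x y :: "'a::complex_inner"
  shows "(norm (a *\<^sub>R x + b *\<^sub>R y))\<^sup>2
    = a\<^sup>2 * (norm x)\<^sup>2 + 2 * a * b * Re (cinner x y) + b\<^sup>2 * (norm y)\<^sup>2"
  unfolding power2_norm_eq_cinner
  by (simp add: Re_cinner_simps Re_cinner_commute [of y x] power2_eq_square algebra_simps)

lemma norm_scaleC: "norm (c *\<^sub>C x) = cmod c * norm (x::'a::complex_inner)"
proof -
  have "(norm (c *\<^sub>C x))\<^sup>2 = Re ((c * cnj c) * cinner x x)"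
    by (simp add: power2_norm_eq_cinner cinner_scaleC_left cinner_scaleC_right mult_ac)
  also have "\<dots> = (cmod c * norm x)\<^sup>2"
    unfolding complex_norm_square [symmetric]
    by (simp add: power_mult_distrib power2_norm_eq_cinner)
  finally show ?thesis by (simp add: power2_eq_iff_nonneg)
qed

lemma cinner_phase: "cmod c = 1 \<Longrightarrow> cinner (c *\<^sub>C x) (c *\<^sub>C y) = cinner x (y::'a::complex_inner)"
  using complex_norm_square [of c]
  by (simp add: cinner_scaleC_left cinner_scaleC_right mult.commute [of "cnj c" c] flip: mult.assoc)

text \<open>Cauchy--Schwarz for the real inner product: expand the squared norm of
  \<open>norm y *\<^sub>R x + (s * norm x) *\<^sub>R y\<close> for \<open>s = 1\<close> and
  \<open>s = - 1\<close>, then cancel the positive factor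
  \<open>2 * norm x * norm y\<close>.\<close>

lemma abs_Re_cinner_le: "\<bar>Re (cinner x y)\<bar> \<le> norm x * norm (y::'a::complex_inner)"
proof (cases "x = 0 \<or> y = 0")
  case True
  then have "Re (cinner x y) = 0"
    using Re_cinner_scaleR_left [of 0 x y] Re_cinner_scaleR_right [of x 0 y] by auto
  then show ?thesis by simp
next
  case False
  define a b where "a = norm x" and "b = norm y"
  have ab: "a * b > 0" using False by (simp add: a_def b_def)
  have "0 \<le> (norm (b *\<^sub>R x + (s * a) *\<^sub>R y))\<^sup>2" for s by simp
  then have *: "0 \<le> b\<^sup>2 * a\<^sup>2 + 2 * b * (s * a) * Re (cinner x y) + (s * a)\<^sup>2 * b\<^sup>2" for s
    by (simp only: power2_norm_add_scaleR a_def b_def)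
  have nonneg: "0 \<le> t" if "0 \<le> 2 * (a * b) * t" for t
    by (rule ccontr) (use mult_pos_neg [of "2 * (a * b)" t] that ab in auto)
  have "0 \<le> a * b + Re (cinner x y)"
    by (rule nonneg) (use * [of 1] in \<open>simp add: power2_eq_square algebra_simps\<close>)
  moreover have "0 \<le> a * b - Re (cinner x y)"
    by (rule nonneg) (use * [of "-1"] in \<open>simp add: power2_eq_square algebra_simps\<close>)
  ultimately show ?thesis by (simp add: a_def b_def abs_le_iff)
qed

text \<open>Supplies the continuity of \<open>Re (cinner (T w) w)\<close> along a segment for the
  intermediate value argument below.\<close>

lemma bounded_bilinear_Re_cinner:
  "bounded_bilinear (\<lambda>x y. Re (cinner x (y::'a::complex_inner)))"
proof
  show "\<exists>K. \<forall>a b. norm (Re (cinner a (b::'a))) \<le> norm a * norm b * K"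
    using abs_Re_cinner_le by (intro exI [of _ 1]) auto
qed (simp_all add: Re_cinner_simps)

section \<open>Convexity of the joint numerical range\<close>

lemma linear_operatorD:
  assumes "linear_operator D T"
  shows "x \<in> D \<Longrightarrow> y \<in> D \<Longrightarrow> x + y \<in> D" "x \<in> D \<Longrightarrow> c *\<^sub>C x \<in> D" "x \<in> D \<Longrightarrow> r *\<^sub>R x \<in> D"
    "x \<in> D \<Longrightarrow> y \<in> D \<Longrightarrow> T (x + y) = T x + T y" "x \<in> D \<Longrightarrow> T (c *\<^sub>C x) = c *\<^sub>C T x"
    "x \<in> D \<Longrightarrow> T (r *\<^sub>R x) = r *\<^sub>R T x"
  using assms
  by (auto simp: linear_operator_def scaleR_scaleC complex_vector.subspace_add
      complex_vector.subspace_scale)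

text \<open>For nonzero \<open>k\<close> the phase \<open>\<i> * cnj k / cmod k\<close> turns
  \<open>k\<close> into \<open>\<i> * cmod k\<close>.\<close>

lemma ex_phase_Re_eq_0: "\<exists>c. cmod c = 1 \<and> Re (c * k) = 0"
proof (cases "k = 0")
  case False
  have "cmod (\<i> * cnj k / cmod k) = 1" using False by (simp add: norm_divide norm_mult)
  moreover have "\<i> * cnj k / cmod k * k = \<i> * complex_of_real (cmod k)"
  proof -
    have "\<i> * cnj k / cmod k * k = \<i> * (k * cnj k) / cmod k" by simp
    also have "\<dots> = \<i> * complex_of_real (cmod k)"
      using False by (simp add: complex_norm_square [symmetric] power2_eq_square)
    finally show ?thesis .
  qed
  then have "Re (\<i> * cnj k / cmod k * k) = 0" by simp
  ultimately show ?thesis by blast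
qed (auto intro: exI [of _ 1])

text \<open>A homogenized affine functional: on unit vectors it equals
  \<open>k * x + l * r + m\<close>, so its zeros there are the vectors whose pair lies on a given
  line.\<close>

definition operator_form :: "('h::complex_inner \<Rightarrow> 'h) \<Rightarrow> real \<Rightarrow> real \<Rightarrow> real \<Rightarrow> 'h \<Rightarrow> real" where
  "operator_form T k l m u = k * Re (cinner (T u) u) + l * (norm (T u))\<^sup>2 + m * (norm u)\<^sup>2"

text \<open>On the real span of \<open>u\<close> and \<open>c *\<^sub>C v\<close> the only mixed
  term is \<open>a * b * Re (c * K)\<close>, and a suitable phase \<open>c\<close> kills it. The
  value at \<open>v\<close> survives the rotation because phases cancel in
  \<open>cinner\<close>.\<close>

lemma operator_form_diagonal:
  assumes T: "linear_operator D T" and uv: "u \<in> D" "v \<in> D"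
  obtains c where "cmod c = 1"
    "\<And>a b. operator_form T k l m (a *\<^sub>R u + b *\<^sub>R (c *\<^sub>C v))
       = a\<^sup>2 * operator_form T k l m u + b\<^sup>2 * operator_form T k l m v"
proof -
  \<comment> \<open>Every cross term is written with \<open>v\<close> or \<open>T v\<close> in the
    first slot, where \<open>c\<close> factors out linearly; conjugate symmetry makes this harmless
    for real parts.\<close>
  define K where "K = k * (cinner v (T u) + cinner (T v) u)
    + complex_of_real (2 * l) * cinner (T v) (T u) + complex_of_real (2 * m) * cinner v u"
  obtain c where c: "cmod c = 1" "Re (c * K) = 0" using ex_phase_Re_eq_0 by blast
  define v' where "v' = c *\<^sub>C v"
  have v': "v' \<in> D" "T v' = c *\<^sub>C T v" using T uv by (auto simp: v'_def linear_operatorD)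
  have left: "cinner v' y = c * cinner v y" "cinner (T v') y = c * cinner (T v) y" for y
    by (simp_all add: v'(2) cinner_scaleC_left) (simp add: v'_def cinner_scaleC_left)
  have "Re (c * K) = k * (Re (cinner v' (T u)) + Re (cinner (T v') u))
      + 2 * l * Re (cinner (T v') (T u)) + 2 * m * Re (cinner v' u)"
    unfolding left by (simp add: K_def algebra_simps)
  then have cross: "k * (Re (cinner (T u) v') + Re (cinner (T v') u))
      + 2 * l * Re (cinner (T u) (T v')) + 2 * m * Re (cinner u v') = 0"
    using c by (simp add: Re_cinner_commute)
  have form_v': "operator_form T k l m v' = operator_form T k l m v"
  proof -
    have "cinner (T v') v' = cinner (T v) v"
      using c unfolding v'(2) by (simp add: v'_def cinner_phase)
    then show ?thesis
      using c by (simp add: operator_form_def v' norm_scaleC) (simp add: v'_def norm_scaleC)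
  qed
  have "operator_form T k l m (a *\<^sub>R u + b *\<^sub>R v')
      = a\<^sup>2 * operator_form T k l m u + b\<^sup>2 * operator_form T k l m v" for a b
  proof -
    have Tw: "T (a *\<^sub>R u + b *\<^sub>R v') = a *\<^sub>R T u + b *\<^sub>R T v'"
      using T uv v' by (simp add: linear_operatorD)
    have "operator_form T k l m (a *\<^sub>R u + b *\<^sub>R v')
      = a\<^sup>2 * operator_form T k l m u + b\<^sup>2 * operator_form T k l m v'
        + a * b * (k * (Re (cinner (T u) v') + Re (cinner (T v') u))
          + 2 * l * Re (cinner (T u) (T v')) + 2 * m * Re (cinner u v'))"
      unfolding operator_form_def Tw power2_norm_add_scaleR
      by (simp add: Re_cinner_simps power2_eq_square algebra_simps)
    then show ?thesis by (simp only: cross form_v')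
  qed
  then show ?thesis using that c by (simp add: v'_def)
qed

text \<open>This is \<open>W\<close>. For an everywhere defined bounded \<open>T\<close> it is the
  joint numerical range of the self-adjoint part of \<open>T\<close> and of the product of the
  adjoint with \<open>T\<close>.\<close>

definition joint_range :: "'h::complex_inner set \<Rightarrow> ('h \<Rightarrow> 'h) \<Rightarrow> (real \<times> real) set" where
  "joint_range D T = {(Re (cinner (T u) u), (norm (T u))\<^sup>2) | u. u \<in> D \<and> norm u = 1}"

text \<open>Both quantities are homogeneous of degree two, so the vectors of a segment can be used
  without normalizing them first.\<close>

lemma joint_rangeI_normalize:
  assumes T: "linear_operator D T" and w: "w \<in> D" "w \<noteq> 0"
  shows "(Re (cinner (T w) w) / (norm w)\<^sup>2, (norm (T w))\<^sup>2 / (norm w)\<^sup>2) \<in> joint_range D T"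
proof -
  define u where "u = inverse (norm w) *\<^sub>R w"
  have "u \<in> D" "norm u = 1" "T u = inverse (norm w) *\<^sub>R T w"
    using T w by (auto simp: u_def linear_operatorD)
  moreover from this have "Re (cinner (T u) u) = Re (cinner (T w) w) / (norm w)\<^sup>2"
    by (simp add: u_def Re_cinner_simps power2_eq_square field_simps)
  ultimately show ?thesis
    by (auto simp: joint_range_def power_mult_distrib field_simps intro!: exI [of _ u])
qed

text \<open>The hypothesis \<open>perp\<close> makes \<open>d\<close> orthogonal to the normal
  \<open>(- e\<^sub>2, e\<^sub>1)\<close>, hence parallel to \<open>e\<close>; the inner product
  with \<open>e\<close> then fixes the factor.\<close>

lemma on_line_eq:
  fixes e\<^sub>1 e\<^sub>2 d\<^sub>1 d\<^sub>2 t :: real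
  assumes "e\<^sub>1 \<noteq> 0 \<or> e\<^sub>2 \<noteq> 0" and perp: "e\<^sub>1 * d\<^sub>2 = e\<^sub>2 * d\<^sub>1"
    and t: "d\<^sub>1 * e\<^sub>1 + d\<^sub>2 * e\<^sub>2 = t * (e\<^sub>1\<^sup>2 + e\<^sub>2\<^sup>2)"
  shows "d\<^sub>1 = t * e\<^sub>1" "d\<^sub>2 = t * e\<^sub>2"
proof -
  have ne: "e\<^sub>1\<^sup>2 + e\<^sub>2\<^sup>2 \<noteq> 0" using assms(1) by (simp add: sum_power2_eq_zero_iff)
  have "(e\<^sub>1\<^sup>2 + e\<^sub>2\<^sup>2) * d\<^sub>1 = (e\<^sub>1\<^sup>2 + e\<^sub>2\<^sup>2) * (t * e\<^sub>1)" using perp t by algebra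
  then show "d\<^sub>1 = t * e\<^sub>1" by (simp only: mult_left_cancel [OF ne])
  have "(e\<^sub>1\<^sup>2 + e\<^sub>2\<^sup>2) * d\<^sub>2 = (e\<^sub>1\<^sup>2 + e\<^sub>2\<^sup>2) * (t * e\<^sub>2)" using perp t by algebra
  then show "d\<^sub>2 = t * e\<^sub>2" by (simp only: mult_left_cancel [OF ne])
qed

text \<open>Toeplitz--Hausdorff: after rotating \<open>v\<close> by a suitable phase, the quadratic form that cuts
  out the line through two points of the range vanishes on the real span of \<open>u\<close> and \<open>v\<close>,
  so the range of the segment from \<open>u\<close> to \<open>v\<close> is a curve inside that line.\<close>

lemma convex_joint_range:
  assumes T: "linear_operator D T"
  shows "convex (joint_range D T)"
  unfolding convex_alt
proof (intro ballI allI impI)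
  fix p q :: "real \<times> real" and t :: real
  assume p: "p \<in> joint_range D T" and q: "q \<in> joint_range D T" and t: "0 \<le> t \<and> t \<le> 1"
  show "(1 - t) *\<^sub>R p + t *\<^sub>R q \<in> joint_range D T"
  proof (cases "p = q")
    case True
    then show ?thesis using p by (simp add: scaleR_left.diff)
  next
    case False
    obtain u where u: "u \<in> D" "norm u = 1" "p = (Re (cinner (T u) u), (norm (T u))\<^sup>2)"
      using p by (auto simp: joint_range_def)
    obtain v where v: "v \<in> D" "norm v = 1" "q = (Re (cinner (T v) v), (norm (T v))\<^sup>2)"
      using q by (auto simp: joint_range_def)
    define x r where "x w = Re (cinner (T w) w)" and "r w = (norm (T w))\<^sup>2" for w
    define e\<^sub>1 e\<^sub>2 where "e\<^sub>1 = x v - x u" and "e\<^sub>2 = r v - r u"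
    have e: "e\<^sub>1 \<noteq> 0 \<or> e\<^sub>2 \<noteq> 0"
      using False u(3) v(3) by (auto simp: e\<^sub>1_def e\<^sub>2_def x_def r_def)
    \<comment> \<open>With this constant, the form with coefficients \<open>- e\<^sub>2\<close>,
      \<open>e\<^sub>1\<close>, \<open>m\<close> is the homogenized equation of the line through
      \<open>p\<close> and \<open>q\<close>.\<close>
    define m where "m = e\<^sub>2 * x u - e\<^sub>1 * r u"
    obtain c where c: "cmod c = 1"
      and diag: "\<And>a b. operator_form T (- e\<^sub>2) e\<^sub>1 m (a *\<^sub>R u + b *\<^sub>R (c *\<^sub>C v))
        = a\<^sup>2 * operator_form T (- e\<^sub>2) e\<^sub>1 m u + b\<^sup>2 * operator_form T (- e\<^sub>2) e\<^sub>1 m v"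
      using operator_form_diagonal [OF T u(1) v(1)] by blast
    have form: "operator_form T (- e\<^sub>2) e\<^sub>1 m w = e\<^sub>1 * r w - e\<^sub>2 * x w + m * (norm w)\<^sup>2" for w
      by (simp add: operator_form_def x_def r_def)
    have form0: "operator_form T (- e\<^sub>2) e\<^sub>1 m u = 0" "operator_form T (- e\<^sub>2) e\<^sub>1 m v = 0"
      unfolding form by (simp_all add: u(2) v(2) m_def e\<^sub>1_def e\<^sub>2_def algebra_simps)
    define v' where "v' = c *\<^sub>C v"
    have Tv': "T v' = c *\<^sub>C T v" and v'D: "v' \<in> D" and nv': "norm v' = 1"
      using T v c by (auto simp: v'_def linear_operatorD norm_scaleC)
    have xv': "x v' = x v" and rv': "r v' = r v"
    proof -
      show "x v' = x v" using c unfolding x_def Tv' by (simp add: v'_def cinner_phase)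
      show "r v' = r v" using c by (simp add: r_def Tv' norm_scaleC)
    qed
    define w where "w s = (1 - s) *\<^sub>R u + s *\<^sub>R v'" for s
    have wD: "w s \<in> D" and Tw: "T (w s) = (1 - s) *\<^sub>R T u + s *\<^sub>R T v'" for s
      using T u v'D by (auto simp: w_def linear_operatorD)
    have w_form: "e\<^sub>1 * r (w s) - e\<^sub>2 * x (w s) + m * (norm (w s))\<^sup>2 = 0" for s
      using diag [of "1 - s" s] form0 form [of "w s"] by (simp add: w_def v'_def)
    \<comment> \<open>A zero on the segment would force, by equality of norms,
      \<open>s = 1 / 2\<close> and \<open>u = - v'\<close>. The pair does not see the sign, so
      \<open>p\<close> and \<open>q\<close> would coincide.\<close>
    have w_ne: "w s \<noteq> 0" if "0 \<le> s" "s \<le> 1" for s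
    proof
      assume 0: "w s = 0"
      then have *: "(1 - s) *\<^sub>R u = (- s) *\<^sub>R v'" by (simp add: w_def add_eq_0_iff2)
      then have "\<bar>1 - s\<bar> = \<bar>s\<bar>" using u(2) nv' by (metis abs_minus norm_scaleR mult.right_neutral)
      then have s: "s = 1 / 2" using that by simp
      have "(1 / 2) *\<^sub>R u = (1 / 2) *\<^sub>R (- 1) *\<^sub>R v'" using * unfolding s by simp
      then have "u = (- 1) *\<^sub>R v'" by (simp only: scaleR_cancel_left) simp
      moreover from this have "T u = (- 1) *\<^sub>R T v'"
        using linear_operatorD(6) [OF T v'D, of "-1"] by (simp only:)
      ultimately have "x u = x v'" "r u = r v'"
        by (simp_all only: x_def r_def Re_cinner_simps norm_scaleR) simp_all
      then show False using e xv' rv' by (simp add: e\<^sub>1_def e\<^sub>2_def)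
    qed
    \<comment> \<open>The coordinate along the line, 0 at \<open>p\<close> and 1 at
      \<open>q\<close>, of the orthogonal projection of the normalized pair of
      \<open>w s\<close>.\<close>
    define \<phi> where "\<phi> s = ((x (w s) / (norm (w s))\<^sup>2 - x u) * e\<^sub>1
        + (r (w s) / (norm (w s))\<^sup>2 - r u) * e\<^sub>2) / (e\<^sub>1\<^sup>2 + e\<^sub>2\<^sup>2)" for s
    have ne: "e\<^sub>1\<^sup>2 + e\<^sub>2\<^sup>2 \<noteq> 0" using e by (simp add: sum_power2_eq_zero_iff)
    have "continuous_on {0..1} (\<lambda>s. x (w s))"
      unfolding x_def Tw unfolding w_def
      by (rule bounded_bilinear.continuous_on [OF bounded_bilinear_Re_cinner])
         (intro continuous_intros)+
    moreover have "continuous_on {0..1} (\<lambda>s. r (w s))"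
      unfolding r_def Tw by (intro continuous_intros)
    moreover have "continuous_on {0..1} w"
      unfolding w_def by (intro continuous_intros)
    ultimately have "continuous_on {0..1} \<phi>"
      unfolding \<phi>_def by (intro continuous_intros) (use w_ne ne in auto)
    moreover have "\<phi> 0 = 0" using u(2) by (simp add: \<phi>_def w_def)
    moreover have "\<phi> 1 = 1"
      using ne nv' xv' rv'
      by (simp add: \<phi>_def w_def e\<^sub>1_def [symmetric] e\<^sub>2_def [symmetric] power2_eq_square)
    ultimately obtain s where s: "0 \<le> s" "s \<le> 1" "\<phi> s = t"
      using IVT' [of \<phi> 0 t 1] t by auto
    have n: "(norm (w s))\<^sup>2 \<noteq> 0" using w_ne s by simp
    define X R where "X = x (w s) / (norm (w s))\<^sup>2" and "R = r (w s) / (norm (w s))\<^sup>2"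
    \<comment> \<open>Dividing the vanishing form by the squared norm puts \<open>(X, R)\<close> on
      the line itself, so its coordinate \<open>t\<close> determines it.\<close>
    have "e\<^sub>1 * R - e\<^sub>2 * X + m = 0"
      using w_form [of s] n unfolding X_def R_def by (simp add: field_simps)
    then have "e\<^sub>1 * (R - r u) = e\<^sub>2 * (X - x u)"
      by (simp add: m_def algebra_simps)
    moreover have "(X - x u) * e\<^sub>1 + (R - r u) * e\<^sub>2 = t * (e\<^sub>1\<^sup>2 + e\<^sub>2\<^sup>2)"
      using s(3) ne by (simp add: \<phi>_def X_def R_def field_simps)
    ultimately have "X - x u = t * e\<^sub>1" "R - r u = t * e\<^sub>2"
      using on_line_eq [OF e] by blast+
    then have "(1 - t) *\<^sub>R p + t *\<^sub>R q = (X, R)"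
      using u(3) v(3) by (simp add: x_def r_def e\<^sub>1_def e\<^sub>2_def algebra_simps)
    moreover have "(X, R) \<in> joint_range D T"
      using joint_rangeI_normalize [OF T wD w_ne [OF s(1,2)]] by (simp add: X_def R_def x_def r_def)
    ultimately show ?thesis by simp
  qed
qed

section \<open>The scaled relative graph and the joint range\<close>

text \<open>The values of \<open>arccos\<close> lie in the interval from 0 to \<open>pi\<close>,
  where the sine is nonnegative, so the sign \<open>s\<close> passes unchanged to the imaginary
  part.\<close>

lemma complex_of_polar_angle:
  assumes "\<bar>x\<bar> \<le> \<rho>" "\<rho> > 0" "\<bar>s\<bar> = 1"
  shows "Re (\<rho> * exp (complex_of_real s * \<i> * complex_of_real (arccos (x / \<rho>)))) = x"
    and "Im (\<rho> * exp (complex_of_real s * \<i> * complex_of_real (arccos (x / \<rho>))))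
      = s * sqrt (\<rho>\<^sup>2 - x\<^sup>2)"
proof -
  have le: "\<bar>x / \<rho>\<bar> \<le> 1" using assms by simp
  have s: "s = 1 \<or> s = - 1" using assms by linarith
  have "\<rho> * sqrt (1 - (x / \<rho>)\<^sup>2) = sqrt (\<rho>\<^sup>2 * (1 - (x / \<rho>)\<^sup>2))"
    using assms by (simp add: real_sqrt_mult)
  also have "\<rho>\<^sup>2 * (1 - (x / \<rho>)\<^sup>2) = \<rho>\<^sup>2 - x\<^sup>2"
    using assms by (simp add: field_simps)
  finally have sq: "\<rho> * sqrt (1 - (x / \<rho>)\<^sup>2) = sqrt (\<rho>\<^sup>2 - x\<^sup>2)" .
  have E: "exp (complex_of_real s * \<i> * complex_of_real \<theta>) = cis (s * \<theta>)" for \<theta>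
    by (simp add: cis_conv_exp mult_ac)
  show "Re (\<rho> * exp (complex_of_real s * \<i> * complex_of_real (arccos (x / \<rho>)))) = x"
    unfolding E using s le assms by (auto simp: cos_arccos_abs)
  show "Im (\<rho> * exp (complex_of_real s * \<i> * complex_of_real (arccos (x / \<rho>))))
      = s * sqrt (\<rho>\<^sup>2 - x\<^sup>2)"
    unfolding E using s le assms sq by (auto simp: sin_arccos_abs)
qed

text \<open>Real part and modulus determine a complex number up to conjugation, and the SRG contains
  both signs of each angle.\<close>

lemma Fin_in_SRG_iff:
  assumes T: "linear_operator D T"
  shows "Fin z \<in> SRG D T \<longleftrightarrow> (Re z, (cmod z)\<^sup>2) \<in> joint_range D T"
proof -
  define pt where "pt u s = complex_of_real (norm (T u) / norm u) *
           exp (complex_of_real s * \<i> * complex_of_real (angle u (T u)))" for u s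
  have norm_pt: "cmod (pt u s) = norm (T u) / norm u" for u s
    by (simp add: pt_def norm_mult norm_divide mult_ac)
  have Re_pt: "Re (pt u s) = Re (cinner (T u) u) / (norm u)\<^sup>2"
    and Im_pt: "Im (pt u s) = s * sqrt ((norm (T u) / norm u)\<^sup>2 - (Re (cinner (T u) u) / (norm u)\<^sup>2)\<^sup>2)"
    if u: "u \<noteq> 0" and s: "\<bar>s\<bar> = 1" for u s
  proof -
    define x \<rho> where "x = Re (cinner (T u) u) / (norm u)\<^sup>2" and "\<rho> = norm (T u) / norm u"
    have le: "\<bar>x\<bar> \<le> \<rho>"
      using abs_Re_cinner_le [of "T u" u] u
      by (simp add: x_def \<rho>_def abs_mult field_simps power2_eq_square)
    have "Re (pt u s) = x \<and> Im (pt u s) = s * sqrt (\<rho>\<^sup>2 - x\<^sup>2)"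
    proof (cases "T u = 0")
      \<comment> \<open>The angle is a convention here, but the modulus is 0 and \<open>le\<close>
        forces \<open>x = 0\<close>.\<close>
      case True
      then have "\<rho> = 0" "pt u s = 0" by (auto simp: \<rho>_def pt_def)
      then show ?thesis using le by simp
    next
      case False
      then have "\<rho> > 0" using u by (simp add: \<rho>_def)
      have "Re (cinner (T u) u) / (norm (T u) * norm u) = x / \<rho>"
        using u by (simp add: x_def \<rho>_def power2_eq_square)
      then have "pt u s = \<rho> * exp (complex_of_real s * \<i> * complex_of_real (arccos (x / \<rho>)))"
        using False by (simp add: pt_def angle_def \<rho>_def)
      then show ?thesis using complex_of_polar_angle [OF le \<open>\<rho> > 0\<close> s] by simp
    qed
    then show "Re (pt u s) = Re (cinner (T u) u) / (norm u)\<^sup>2"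
      "Im (pt u s) = s * sqrt ((norm (T u) / norm u)\<^sup>2 - (Re (cinner (T u) u) / (norm u)\<^sup>2)\<^sup>2)"
      by (auto simp: x_def \<rho>_def)
  qed
  show ?thesis
  proof
    assume "Fin z \<in> SRG D T"
    then obtain u s where u: "u \<in> D" "u \<noteq> 0" "s = 1 \<or> s = - 1" and z: "z = pt u s"
      by (auto simp: SRG_def pt_def)
    have "\<bar>s\<bar> = 1" using u(3) by auto
    then show "(Re z, (cmod z)\<^sup>2) \<in> joint_range D T"
      using joint_rangeI_normalize [OF T u(1,2)] u(2)
      by (simp add: z Re_pt norm_pt power_divide)
  next
    assume "(Re z, (cmod z)\<^sup>2) \<in> joint_range D T"
    then obtain u where u: "u \<in> D" "norm u = 1" "Re z = Re (cinner (T u) u)"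
        "(cmod z)\<^sup>2 = (norm (T u))\<^sup>2"
      by (auto simp: joint_range_def)
    \<comment> \<open>The square root recovers only the absolute value of \<open>Im z\<close>;
      \<open>s\<close> selects the half plane.\<close>
    define s :: real where "s = (if Im z \<ge> 0 then 1 else - 1)"
    have s: "s \<in> {1, - 1}" "\<bar>s\<bar> = 1" by (auto simp: s_def)
    have "u \<noteq> 0" using u(2) by auto
    have "(norm (T u))\<^sup>2 - (Re z)\<^sup>2 = (Im z)\<^sup>2" using u(4) by (simp add: cmod_power2)
    then have "z = pt u s"
      using u \<open>u \<noteq> 0\<close> s by (simp add: complex_eq_iff Re_pt Im_pt) (simp add: s_def)
    then show "Fin z \<in> SRG D T"
      using u(1) \<open>u \<noteq> 0\<close> s(1) unfolding SRG_def pt_def by blast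
  qed
qed

lemma Infty_notin_SRG: "Infty \<notin> SRG D T"
  by (auto simp: SRG_def)

section \<open>Gains of shifted operators\<close>

lemma normalized_gain:
  assumes "linear_operator D T" "u \<in> D" "u \<noteq> 0"
  obtains v where "v \<in> D" "norm v = 1"
    "norm (T u - \<alpha> *\<^sub>R u) / norm u = norm (T v - \<alpha> *\<^sub>R v)"
proof -
  define v where "v = inverse (norm u) *\<^sub>R u"
  have "T v - \<alpha> *\<^sub>R v = inverse (norm u) *\<^sub>R (T u - \<alpha> *\<^sub>R u)"
    using assms by (simp add: v_def linear_operatorD scaleR_diff_right)
  then have "norm (T v - \<alpha> *\<^sub>R v) = norm (T u - \<alpha> *\<^sub>R u) / norm u"
    by (simp only: norm_scaleR) (simp add: field_simps)
  moreover have "v \<in> D" "norm v = 1" using assms by (auto simp: v_def linear_operatorD)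
  ultimately show ?thesis using that by simp
qed

lemma power2_norm_shift:
  assumes "norm u = 1"
  shows "(norm (T u - \<alpha> *\<^sub>R u))\<^sup>2 = (norm (T u))\<^sup>2 - 2 * \<alpha> * Re (cinner (T u) u) + \<alpha>\<^sup>2"
  using power2_norm_add_scaleR [of 1 "T u" "- \<alpha>" u] assms by simp

text \<open>The same affine function of the pair as in \<open>power2_norm_shift\<close>, so that
  comparing \<open>z\<close> with gains means comparing pairs by linear inequalities.\<close>

lemma power2_cmod_shift: "(cmod (z - of_real \<alpha>))\<^sup>2 = (cmod z)\<^sup>2 - 2 * \<alpha> * Re z + \<alpha>\<^sup>2"
  unfolding cmod_power2 by (simp add: power2_eq_square algebra_simps)

lemma Fin_in_Ann_iff:
  "Fin z \<in> Ann D T \<alpha> \<longleftrightarrow>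
     min_gain D (\<lambda>u. T u - \<alpha> *\<^sub>R u) \<le> ennreal (cmod (z - of_real \<alpha>)) \<and>
     ennreal (cmod (z - of_real \<alpha>)) \<le> max_gain D (\<lambda>u. T u - \<alpha> *\<^sub>R u)"
proof -
  have "z = of_real \<alpha> + y \<longleftrightarrow> y = z - of_real \<alpha>" for y by auto
  then show ?thesis by (simp add: Ann_def Let_def)
qed

lemma Infty_in_Ann_iff: "Infty \<in> Ann D T \<alpha> \<longleftrightarrow> max_gain D (\<lambda>u. T u - \<alpha> *\<^sub>R u) = \<infinity>"
  by (simp add: Ann_def Let_def)

text \<open>A unit vector that produces \<open>z\<close> has the same pair as \<open>z\<close>, so
  \<open>cmod (z - of_real \<alpha>)\<close> is one of the ratios over which the gains are
  taken.\<close>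

lemma SRG_subset_Ann:
  assumes T: "linear_operator D T" and z: "Fin z \<in> SRG D T"
  shows "Fin z \<in> Ann D T \<alpha>"
proof -
  obtain u where u: "u \<in> D" "norm u = 1" "Re z = Re (cinner (T u) u)" "(cmod z)\<^sup>2 = (norm (T u))\<^sup>2"
    using z by (auto simp: Fin_in_SRG_iff [OF T] joint_range_def)
  have "(cmod (z - of_real \<alpha>))\<^sup>2 = (norm (T u - \<alpha> *\<^sub>R u))\<^sup>2"
    using u by (simp add: power2_norm_shift power2_cmod_shift)
  then have "cmod (z - of_real \<alpha>) = norm (T u - \<alpha> *\<^sub>R u) / norm u"
    using u(2) by simp
  moreover have "u \<in> D - {0}" using u by auto
  ultimately show ?thesis
    unfolding Fin_in_Ann_iff min_gain_def max_gain_def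
    by (auto intro: INF_lower SUP_upper)
qed

section \<open>Convergence in the extended plane\<close>

lemma tendsto_stereo:
  assumes "(\<lambda>n. f n) \<longlonglongrightarrow> p"
  shows "(\<lambda>n. stereo (f n)) \<longlonglongrightarrow> stereo p"
proof -
  have "(\<lambda>n. dist (f n) p) \<longlonglongrightarrow> 0" using assms by (rule tendsto_dist_iff [THEN iffD1])
  then have "(\<lambda>n. dist (f n) p / 2) \<longlonglongrightarrow> 0 / 2" by (intro tendsto_intros) simp_all
  then have "(\<lambda>n. dist (stereo (f n)) (stereo p)) \<longlonglongrightarrow> 0"
    by (simp add: dist_ecomplex_def chordal_stereo)
  then show ?thesis by (rule tendsto_dist_iff [THEN iffD2])
qed

text \<open>Forwards, dividing the first component of \<open>stereo\<close> by the second recovers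
  the point; backwards, the chordal distance is at most twice the Euclidean one.\<close>

lemma tendsto_Fin_iff: "(\<lambda>n. Fin (z n)) \<longlonglongrightarrow> Fin w \<longleftrightarrow> z \<longlonglongrightarrow> w"
proof
  have pos: "1 + (cmod y)\<^sup>2 > 0" for y by (simp add: add_pos_nonneg)
  assume "(\<lambda>n. Fin (z n)) \<longlonglongrightarrow> Fin w"
  then have S: "(\<lambda>n. stereo (Fin (z n))) \<longlonglongrightarrow> stereo (Fin w)" by (rule tendsto_stereo)
  have "(\<lambda>n. fst (stereo (Fin (z n))) /\<^sub>R snd (stereo (Fin (z n))))
      \<longlonglongrightarrow> fst (stereo (Fin w)) /\<^sub>R snd (stereo (Fin w))"
    using pos [of w] by (intro tendsto_intros S) simp
  moreover have "fst (stereo (Fin y)) /\<^sub>R snd (stereo (Fin y)) = y" for y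
    using pos [of y] by simp
  ultimately show "z \<longlonglongrightarrow> w" by simp
next
  assume z: "z \<longlonglongrightarrow> w"
  show "(\<lambda>n. Fin (z n)) \<longlonglongrightarrow> Fin w"
  proof (rule metric_tendsto_imp_tendsto)
    show "(\<lambda>n. 2 *\<^sub>R z n) \<longlonglongrightarrow> 2 *\<^sub>R w" using z by (intro tendsto_intros)
    show "\<forall>\<^sub>F n in sequentially. dist (Fin (z n)) (Fin w) \<le> dist (2 *\<^sub>R z n) (2 *\<^sub>R w)"
    proof (intro always_eventually allI)
      fix n
      have "1 * 1 \<le> sqrt (1 + (cmod (z n))\<^sup>2) * sqrt (1 + (cmod w)\<^sup>2)"
        by (intro mult_mono) auto
      then have "chordal (Fin (z n)) (Fin w) \<le> 2 * cmod (z n - w) / 1"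
        by (simp only: chordal.simps) (intro divide_left_mono, auto)
      then show "dist (Fin (z n)) (Fin w) \<le> dist (2 *\<^sub>R z n) (2 *\<^sub>R w)"
        by (simp add: dist_ecomplex_def dist_norm flip: scaleR_diff_right)
    qed
  qed
qed

text \<open>The second component of \<open>stereo\<close> is
  \<open>1 / (1 + (cmod z)\<^sup>2)\<close>, and its decay to 0 means growth of the modulus.
  Conversely, the chordal distance to \<open>Infty\<close> is at most
  \<open>2 / cmod z\<close>.\<close>

lemma tendsto_Infty_iff: "(\<lambda>n. Fin (z n)) \<longlonglongrightarrow> Infty \<longleftrightarrow> filterlim (\<lambda>n. cmod (z n)) at_top sequentially"
proof
  assume "(\<lambda>n. Fin (z n)) \<longlonglongrightarrow> Infty"
  then have "(\<lambda>n. snd (stereo (Fin (z n)))) \<longlonglongrightarrow> snd (stereo Infty)"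
    by (intro tendsto_snd tendsto_stereo)
  then have "(\<lambda>n. inverse (1 + (cmod (z n))\<^sup>2)) \<longlonglongrightarrow> 0"
    by (simp add: inverse_eq_divide)
  then have "filterlim (\<lambda>n. inverse (inverse (1 + (cmod (z n))\<^sup>2))) at_top sequentially"
    by (rule filterlim_inverse_at_top) (simp add: add_pos_nonneg)
  then have sq: "filterlim (\<lambda>n. 1 + (cmod (z n))\<^sup>2) at_top sequentially" by simp
  show "filterlim (\<lambda>n. cmod (z n)) at_top sequentially"
    unfolding filterlim_at_top_gt [of _ _ 0]
  proof (intro allI impI)
    fix B :: real assume "B > 0"
    have "\<forall>\<^sub>F n in sequentially. 1 + B\<^sup>2 \<le> 1 + (cmod (z n))\<^sup>2"
      using sq by (simp only: filterlim_at_top)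
    then show "\<forall>\<^sub>F n in sequentially. B \<le> cmod (z n)"
      by eventually_elim (rule power2_le_imp_le, auto)
  qed
next
  assume z: "filterlim (\<lambda>n. cmod (z n)) at_top sequentially"
  show "(\<lambda>n. Fin (z n)) \<longlonglongrightarrow> Infty"
  proof (subst tendsto_dist_iff, rule tendsto_sandwich [of "\<lambda>_. 0" _ _ "\<lambda>n. 2 * inverse (cmod (z n))"])
    show "(\<lambda>n. 2 * inverse (cmod (z n))) \<longlonglongrightarrow> 0"
      using tendsto_mult [OF tendsto_const tendsto_inverse_0_at_top [OF z], of 2] by simp
    show "\<forall>\<^sub>F n in sequentially. dist (Fin (z n)) Infty \<le> 2 * inverse (cmod (z n))"
    proof -
      have "\<forall>\<^sub>F n in sequentially. 1 \<le> cmod (z n)" using z by (simp only: filterlim_at_top)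
      then show ?thesis
      proof eventually_elim
        case (elim n)
        have "cmod (z n) \<le> sqrt (1 + (cmod (z n))\<^sup>2)" by (intro real_le_rsqrt) simp
        then have "2 / sqrt (1 + (cmod (z n))\<^sup>2) \<le> 2 / cmod (z n)"
          using elim by (intro divide_left_mono mult_pos_pos) (auto simp: add_pos_nonneg)
        then show ?case by (simp add: dist_ecomplex_def inverse_eq_divide)
      qed
    qed
  qed auto
qed

section \<open>The two inclusions\<close>

text \<open>The annulus inequalities are not strict, so they survive finite limits. A sequence
  tending to \<open>Infty\<close> pushes the maximum gain above every natural number, since the
  shift changes moduli by at most \<open>\<bar>\<alpha>\<bar>\<close>.\<close>

lemma closure_SRG_subset_Ann:
  assumes T: "linear_operator D T"
  shows "closure (SRG D T) \<subseteq> Ann D T \<alpha>"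
proof
  fix p assume "p \<in> closure (SRG D T)"
  then obtain f where f: "\<And>n. f n \<in> SRG D T" "f \<longlonglongrightarrow> p"
    by (auto simp: closure_sequential)
  have "\<exists>z. f n = Fin z" for n
    using f(1) [of n] Infty_notin_SRG by (cases "f n") auto
  then obtain z where "\<And>n. f n = Fin (z n)" by metis
  then have f_eq: "f = (\<lambda>n. Fin (z n))" by auto
  have gains: "min_gain D (\<lambda>u. T u - \<alpha> *\<^sub>R u) \<le> ennreal (cmod (z n - of_real \<alpha>))"
    "ennreal (cmod (z n - of_real \<alpha>)) \<le> max_gain D (\<lambda>u. T u - \<alpha> *\<^sub>R u)" for n
    using SRG_subset_Ann [OF T, of "z n" \<alpha>] f(1) by (auto simp: f_eq Fin_in_Ann_iff)
  show "p \<in> Ann D T \<alpha>"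
  proof (cases p)
    case (Fin w)
    then have "z \<longlonglongrightarrow> w" using f(2) by (simp add: f_eq tendsto_Fin_iff)
    then have "(\<lambda>n. ennreal (cmod (z n - of_real \<alpha>))) \<longlonglongrightarrow> ennreal (cmod (w - of_real \<alpha>))"
      by (intro tendsto_intros)
    then show ?thesis
      unfolding Fin Fin_in_Ann_iff using gains
      by (auto intro: LIMSEQ_le_const LIMSEQ_le_const2)
  next
    case Infty
    then have lim: "filterlim (\<lambda>n. cmod (z n)) at_top sequentially"
      using f(2) by (simp add: f_eq tendsto_Infty_iff)
    have "of_nat k \<le> max_gain D (\<lambda>u. T u - \<alpha> *\<^sub>R u)" for k :: nat
    proof -
      have "\<forall>\<^sub>F n in sequentially. real k + \<bar>\<alpha>\<bar> \<le> cmod (z n)"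
        using lim by (simp only: filterlim_at_top)
      then obtain n where n: "real k + \<bar>\<alpha>\<bar> \<le> cmod (z n)"
        by (metis eventually_sequentially order_refl)
      have "cmod (z n) \<le> cmod (z n - of_real \<alpha>) + \<bar>\<alpha>\<bar>"
        using norm_triangle_sub [of "z n" "of_real \<alpha>"] by (simp add: add.commute)
      then have "real k \<le> cmod (z n - of_real \<alpha>)" using n by linarith
      then have "ennreal (real k) \<le> ennreal (cmod (z n - of_real \<alpha>))" by (rule ennreal_leI)
      from order_trans [OF this gains(2)] show ?thesis by (simp add: ennreal_of_nat_eq_real_of_nat)
    qed
    then have "max_gain D (\<lambda>u. T u - \<alpha> *\<^sub>R u) = \<infinity>"
      by (metis ennreal_Ex_less_of_nat infinity_ennreal_def not_less top.not_eq_extremum)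
    then show ?thesis by (simp add: Infty Infty_in_Ann_iff)
  qed
qed

section \<open>Approximation by points of the scaled relative graph\<close>

lemma Infty_in_closure_SRG:
  assumes T: "linear_operator D T" and inf: "max_gain D T = \<infinity>"
  shows "Infty \<in> closure (SRG D T)"
proof -
  \<comment> \<open>An infinite supremum provides ratios above every \<open>n\<close>, and each
    ratio is the modulus of a point of the SRG.\<close>
  have "\<exists>z. Fin z \<in> SRG D T \<and> real n \<le> cmod z" for n
  proof -
    have "of_nat n < max_gain D T" by (simp add: inf of_nat_less_top)
    then obtain u where u: "u \<in> D" "u \<noteq> 0" "ennreal (real n) < ennreal (norm (T u) / norm u)"
      by (auto simp: max_gain_def less_SUP_iff ennreal_of_nat_eq_real_of_nat)
    define z where "z = complex_of_real (norm (T u) / norm u)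
      * exp (complex_of_real 1 * \<i> * complex_of_real (angle u (T u)))"
    have "cmod z = norm (T u) / norm u" by (simp add: z_def norm_mult norm_divide)
    then have "real n \<le> cmod z" using u(3) by (simp add: ennreal_less_iff)
    moreover have "Fin z \<in> SRG D T" unfolding SRG_def z_def using u by blast
    ultimately show ?thesis by blast
  qed
  then obtain z where z: "\<And>n. Fin (z n) \<in> SRG D T" "\<And>n. real n \<le> cmod (z n)" by metis
  have "filterlim (\<lambda>n. cmod (z n)) at_top sequentially"
    by (rule filterlim_at_top_mono [OF filterlim_real_sequentially]) (simp add: z)
  then have "(\<lambda>n. Fin (z n)) \<longlonglongrightarrow> Infty" by (simp add: tendsto_Infty_iff)
  then show ?thesis
    using z(1) by (auto simp: closure_sequential intro!: exI [of _ "\<lambda>n. Fin (z n)"])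
qed

text \<open>The continuous map from \<open>(x, r)\<close> to
  \<open>Complex x (s * sqrt (r - x\<^sup>2))\<close> lifts the joint range into the SRG. Giving
  \<open>s\<close> the sign of \<open>Im z\<close> makes the lifted sequence converge to
  \<open>z\<close> and not to its conjugate.\<close>

lemma Fin_in_closure_SRG:
  assumes T: "linear_operator D T" and z: "(Re z, (cmod z)\<^sup>2) \<in> closure (joint_range D T)"
  shows "Fin z \<in> closure (SRG D T)"
proof -
  obtain g where g: "\<And>n. g n \<in> joint_range D T" "g \<longlonglongrightarrow> (Re z, (cmod z)\<^sup>2)"
    using z by (auto simp: closure_sequential)
  define x r where "x n = fst (g n)" and "r n = snd (g n)" for n
  have lim: "x \<longlonglongrightarrow> Re z" "r \<longlonglongrightarrow> (cmod z)\<^sup>2"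
    using tendsto_fst [OF g(2)] tendsto_snd [OF g(2)] by (simp_all add: x_def [abs_def] r_def [abs_def])
  \<comment> \<open>By Cauchy--Schwarz the joint range lies on or above the parabola, so the root
    used for the lift is that of a nonnegative number.\<close>
  have le: "(x n)\<^sup>2 \<le> r n" for n
  proof -
    obtain u where u: "norm u = 1" "g n = (Re (cinner (T u) u), (norm (T u))\<^sup>2)"
      using g(1) [of n] by (auto simp: joint_range_def)
    then show ?thesis
      using abs_Re_cinner_le [of "T u" u] abs_le_square_iff [of "Re (cinner (T u) u)" "norm (T u)"]
      by (simp add: x_def r_def)
  qed
  define s :: real where "s = (if Im z \<ge> 0 then 1 else - 1)"
  define y where "y n = Complex (x n) (s * sqrt (r n - (x n)\<^sup>2))" for n
  have s2: "s\<^sup>2 = 1" by (simp add: s_def)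
  have "(Re (y n), (cmod (y n))\<^sup>2) = g n" for n
    using le [of n] by (simp add: y_def cmod_power2 power_mult_distrib s2 x_def r_def)
  then have "Fin (y n) \<in> SRG D T" for n using g(1) by (simp add: Fin_in_SRG_iff [OF T])
  moreover have "y \<longlonglongrightarrow> Complex (Re z) (s * sqrt ((cmod z)\<^sup>2 - (Re z)\<^sup>2))"
    unfolding y_def by (intro tendsto_intros lim)
  moreover have "Complex (Re z) (s * sqrt ((cmod z)\<^sup>2 - (Re z)\<^sup>2)) = z"
    by (simp add: cmod_power2 s_def complex_eq_iff)
  ultimately show ?thesis
    unfolding closure_sequential
    by (intro exI [of _ "\<lambda>n. Fin (y n)"]) (simp add: tendsto_Fin_iff)
qed

section \<open>Separating lines and violated annuli\<close>

lemma min_gain_geI: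
  assumes T: "linear_operator D T"
    and "\<And>u. u \<in> D \<Longrightarrow> norm u = 1 \<Longrightarrow> B \<le> (norm (T u - \<alpha> *\<^sub>R u))\<^sup>2"
  shows "ennreal (sqrt B) \<le> min_gain D (\<lambda>u. T u - \<alpha> *\<^sub>R u)"
  unfolding min_gain_def
proof (rule INF_greatest)
  fix u assume "u \<in> D - {0}"
  then obtain v where "v \<in> D" "norm v = 1" "norm (T u - \<alpha> *\<^sub>R u) / norm u = norm (T v - \<alpha> *\<^sub>R v)"
    using normalized_gain [OF T] by blast
  \<comment> \<open>A negative \<open>B\<close> has a negative \<open>sqrt B\<close>, which
    \<open>ennreal\<close> truncates to 0.\<close>
  then show "ennreal (sqrt B) \<le> ennreal (norm (T u - \<alpha> *\<^sub>R u) / norm u)"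
    using assms(2) [of v] by (simp add: ennreal_leI real_le_lsqrt real_sqrt_le_iff)
qed

lemma max_gain_leI:
  assumes T: "linear_operator D T"
    and "\<And>u. u \<in> D \<Longrightarrow> norm u = 1 \<Longrightarrow> (norm (T u - \<alpha> *\<^sub>R u))\<^sup>2 \<le> B"
  shows "max_gain D (\<lambda>u. T u - \<alpha> *\<^sub>R u) \<le> ennreal (sqrt B)"
  unfolding max_gain_def
proof (rule SUP_least)
  fix u assume "u \<in> D - {0}"
  then obtain v where "v \<in> D" "norm v = 1" "norm (T u - \<alpha> *\<^sub>R u) / norm u = norm (T v - \<alpha> *\<^sub>R v)"
    using normalized_gain [OF T] by blast
  then show "ennreal (norm (T u - \<alpha> *\<^sub>R u) / norm u) \<le> ennreal (sqrt B)"
    using assms(2) [of v] by (simp add: ennreal_leI real_le_rsqrt)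
qed

text \<open>Completing the square turns a strictly separating line with
  \<open>a\<^sub>2 \<noteq> 0\<close> into a comparison of squared distances from a real centre with
  a constant. The sign of \<open>a\<^sub>2\<close> decides which gain bound \<open>z\<close> would
  violate.\<close>

lemma in_closure_joint_range:
  assumes T: "linear_operator D T" and z: "\<And>\<alpha>. Fin z \<in> Ann D T \<alpha>"
  shows "(Re z, (cmod z)\<^sup>2) \<in> closure (joint_range D T)"
proof (rule ccontr)
  assume notin: "(Re z, (cmod z)\<^sup>2) \<notin> closure (joint_range D T)"
  have convex: "convex (closure (joint_range D T))"
    by (intro convex_closure convex_joint_range T)
  obtain a b where ab: "a \<bullet> (Re z, (cmod z)\<^sup>2) < b"
      "\<And>y. y \<in> closure (joint_range D T) \<Longrightarrow> b < a \<bullet> y"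
    using separating_hyperplane_closed_point [OF convex closed_closure notin] by blast
  obtain a\<^sub>1 a\<^sub>2 where a: "a\<^sub>1 * Re z + a\<^sub>2 * (cmod z)\<^sup>2 < b" "a\<^sub>2 \<noteq> 0"
    and sep: "\<And>u. u \<in> D \<Longrightarrow> norm u = 1 \<Longrightarrow> b < a\<^sub>1 * Re (cinner (T u) u) + a\<^sub>2 * (norm (T u))\<^sup>2"
  proof -
    have z_less: "fst a * Re z + snd a * (cmod z)\<^sup>2 < b"
      using ab(1) by (cases a) simp
    have sep: "b < fst a * Re (cinner (T u) u) + snd a * (norm (T u))\<^sup>2"
      if "u \<in> D" "norm u = 1" for u
    proof -
      have "(Re (cinner (T u) u), (norm (T u))\<^sup>2) \<in> closure (joint_range D T)"
        using that closure_subset by (fastforce simp: joint_range_def)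
      from ab(2) [OF this] show ?thesis by (cases a) simp
    qed
    show thesis
    proof (cases "snd a = 0")
      case True
      \<comment> \<open>Tilts a vertical line: \<open>\<delta>\<close> is small enough that
        \<open>\<delta> * (cmod z)\<^sup>2\<close> stays below the slack at \<open>z\<close>, while
        on the joint range the added term is nonnegative.\<close>
      define \<delta> where "\<delta> = (b - fst a * Re z) / (1 + (cmod z)\<^sup>2)"
      have pos: "1 + (cmod z)\<^sup>2 > 0" by (simp add: add_pos_nonneg)
      have \<delta>: "\<delta> > 0" using z_less True pos by (simp add: \<delta>_def)
      have "\<delta> * (1 + (cmod z)\<^sup>2) = b - fst a * Re z" using pos by (simp add: \<delta>_def)
      then have "fst a * Re z + \<delta> * (cmod z)\<^sup>2 < b" using \<delta> by (simp add: algebra_simps)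
      moreover have "b < fst a * Re (cinner (T u) u) + \<delta> * (norm (T u))\<^sup>2"
        if "u \<in> D" "norm u = 1" for u
        using sep [OF that] True \<delta> by (simp add: add_strict_increasing2 less_le_trans)
      ultimately show thesis using that \<delta> by force
    next
      case False
      then show thesis using that z_less sep by blast
    qed
  qed
  \<comment> \<open>The centre and the squared radius come from completing the square in
    \<open>a\<^sub>1 * x + a\<^sub>2 * r = b\<close>.\<close>
  define \<alpha> where "\<alpha> = - a\<^sub>1 / (2 * a\<^sub>2)"
  define B where "B = b / a\<^sub>2 + \<alpha>\<^sup>2"
  have a\<^sub>1: "a\<^sub>1 = - 2 * \<alpha> * a\<^sub>2" using a(2) by (simp add: \<alpha>_def)
  have b: "b = (B - \<alpha>\<^sup>2) * a\<^sub>2" using a(2) by (simp add: B_def)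
  have z_less: "a\<^sub>2 * (cmod (z - of_real \<alpha>))\<^sup>2 < a\<^sub>2 * B"
    using a(1) unfolding a\<^sub>1 b power2_cmod_shift by (simp add: algebra_simps)
  have u_greater: "a\<^sub>2 * B < a\<^sub>2 * (norm (T u - \<alpha> *\<^sub>R u))\<^sup>2" if "u \<in> D" "norm u = 1" for u
    using sep [OF that] unfolding a\<^sub>1 b power2_norm_shift [OF that(2)] by (simp add: algebra_simps)
  have gains: "min_gain D (\<lambda>u. T u - \<alpha> *\<^sub>R u) \<le> ennreal (cmod (z - of_real \<alpha>))"
     "ennreal (cmod (z - of_real \<alpha>)) \<le> max_gain D (\<lambda>u. T u - \<alpha> *\<^sub>R u)"
    using z [of \<alpha>] by (auto simp: Fin_in_Ann_iff)
  show False
  proof (cases "a\<^sub>2 > 0")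
    \<comment> \<open>Here \<open>z\<close> lies strictly inside the circle of radius
      \<open>sqrt B\<close> about \<alpha>, against the minimum gain.\<close>
    case True
    then have "ennreal (sqrt B) \<le> min_gain D (\<lambda>u. T u - \<alpha> *\<^sub>R u)"
      using u_greater by (intro min_gain_geI [OF T]) (simp add: less_imp_le)
    then have "ennreal (sqrt B) \<le> ennreal (cmod (z - of_real \<alpha>))" using gains(1) by (rule order_trans)
    then have "sqrt B \<le> cmod (z - of_real \<alpha>)" by (simp add: ennreal_le_iff)
    moreover have "cmod (z - of_real \<alpha>) < sqrt B"
      using z_less True by (intro real_less_rsqrt) simp
    ultimately show False by simp
  next
    \<comment> \<open>Now \<open>z\<close> lies strictly outside the circle, against the maximum
      gain.\<close>
    case False
    then have neg: "a\<^sub>2 < 0" using a(2) by simp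
    have "D - {0} \<noteq> {}"
    proof
      \<comment> \<open>On the domain \<open>{0}\<close> the maximum gain is 0, so only the infinite minimum gain excludes \<open>z\<close>.\<close>
      assume "D - {0} = {}"
      then have "min_gain D (\<lambda>u. T u - \<alpha> *\<^sub>R u) = \<infinity>" by (simp only: min_gain_def) simp
      then show False using gains(1) by (simp add: top_unique)
    qed
    then obtain u where "u \<in> D" "norm u = 1" using normalized_gain [OF T] by blast
    then have "(norm (T u - \<alpha> *\<^sub>R u))\<^sup>2 < B" using u_greater neg by simp
    \<comment> \<open>Positivity keeps \<open>ennreal\<close> from truncating \<open>sqrt B\<close>,
      so the bound can be read back in the reals.\<close>
    then have "B > 0" by (meson le_less_trans zero_le_power2)
    have "max_gain D (\<lambda>u. T u - \<alpha> *\<^sub>R u) \<le> ennreal (sqrt B)"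
      using u_greater neg by (intro max_gain_leI [OF T]) (simp add: less_imp_le)
    with gains(2) have "ennreal (cmod (z - of_real \<alpha>)) \<le> ennreal (sqrt B)" by (rule order_trans)
    then have "cmod (z - of_real \<alpha>) \<le> sqrt B" using \<open>B > 0\<close> by (simp add: ennreal_le_iff)
    moreover have "sqrt B < cmod (z - of_real \<alpha>)"
      using z_less neg by (intro real_less_lsqrt) simp_all
    ultimately show False by simp
  qed
qed

theorem corollary1:
  fixes D :: "'h::chilbert_space set" and T :: "'h \<Rightarrow> 'h"
  assumes "closed_operator D T"
  shows "closure (SRG D T) = (\<Inter>\<alpha>::real. Ann D T \<alpha>)"
proof
  have T: "linear_operator D T" using assms by (simp add: closed_operator_def)
  show "closure (SRG D T) \<subseteq> (\<Inter>\<alpha>::real. Ann D T \<alpha>)"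
    using closure_SRG_subset_Ann [OF T] by blast
  show "(\<Inter>\<alpha>::real. Ann D T \<alpha>) \<subseteq> closure (SRG D T)"
  proof
    fix p assume p: "p \<in> (\<Inter>\<alpha>::real. Ann D T \<alpha>)"
    show "p \<in> closure (SRG D T)"
    proof (cases p)
      case (Fin z)
      then show ?thesis
        using p by (auto intro!: Fin_in_closure_SRG in_closure_joint_range T)
    next
      case Infty
      \<comment> \<open>The annulus at 0 suffices, because the unshifted operator already has
        infinite maximum gain.\<close>
      then have "Infty \<in> Ann D T 0" using p by blast
      then show ?thesis
        using Infty_in_closure_SRG [OF T] by (simp add: Infty Infty_in_Ann_iff)
    qed
  qed
qed

end
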